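(* Let $R$ be an associative ring with identity, $\Sigma$ a multiplicative set of square matrices over $R$, and $X$ a unital left $R$-module. Let $n,m$ be positive integers, let $a \in R^n$, $C \in \Sigma_n$, $x \in X^n$, and let $b \in R^m$, $D \in \Sigma_m$, $y \in X^m$. The following conditions are equivalent: (1) $(a,C,x^t) \sim (b,D,y^t)$; (2) there exist $u \in R^k$, $E, F \in \Sigma_k$, $z \in X^k$, for some positive integer $k$, such that $(a,C,x^t) + (0,E,z^t) \geq (b,D,y^t) + (u,F,0^t)$; (3) there exist triples $(a_1,C_1,x_1^t)$ and $(b_1,D_1,y_1^t)$ such that $(a,C,x^t) \leq (a_1,C_1,x_1^t)$, $(a_1,C_1,x_1^t) \geq (b_1,D_1,y_1^t)$, and $(b_1,D_1,y_1^t) \leq (b,D,y^t)$.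
   Context: $R$ is an associative ring with identity $1$, not necessarily commutative; $X$ is a unital left $R$-module. Elements of $R^n$ and $X^n$ are row vectors, and $x^t$ denotes the transpose (column vector). A set $\Sigma$ of square matrices over $R$ is multiplicative if it contains all permutation matrices over $R$ (of every size, in particular all identity matrices), is closed under multiplication (when defined), and whenever $C,D \in \Sigma$ then $\left[\begin{array}{cc} C & A \\ 0 & D \end{array}\right] \in \Sigma$ for any matrix $A$ over $R$ of the appropriate size. $\Sigma_n$ denotes the set of $n\times n$ matrices in $\Sigma$. A triple is an ordered triple $(a,C,x^t)$ with $a \in R^n$, $C \in \Sigma_n$, $x \in X^n$ for some positive integer $n$ (different triples may have different $n$). The sum of triples is $$(a,C,x^t)+(b,D,y^t) = \left([a\;\; b], \left[\begin{array}{cc} C & 0 \\ 0 & D\end{array}\right], \left[\begin{array}{c} x^t \\ y^t\end{array}\right]\right).$$ Congruence: for $a,b\in R^n$, $C_1,C_2\in\Sigma_n$, $x,y\in X^n$, write $(a,C_1,x^t)\equiv(b,C_2,y^t)$ if there exist invertible $n\times n$ matrices $U_1,U_2$ over $R$ with $a=bU_1$, $y^t=U_2x^t$, and $C_2U_1=U_2C_1$. Addition of triples is commutative up to $\equiv$. $\Sigma^{-1}X_0$ is the subsemigroup generated by all triples of the form $(0,C,x^t)$ or $(b,D,0^t)$; up to $\equiv$ its elements can be put in the form $(0,C,x^t)+(b,D,0^t)$. Equivalence: $(a,C,x^t)\sim(b,D,y^t)$ means that there exist $z_1,z_2\in\Sigma^{-1}X_0$ such that $(a,C,x^t)+z_1\equiv(b,D,y^t)+z_2$.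 (This is an equivalence relation on triples.) The relation $\geq$: for $a\in R^n$, $C_1\in\Sigma_n$, $x\in X^n$ and $b\in R^m$, $C_2\in\Sigma_m$, $y\in X^m$, write $(a,C_1,x^t)\geq(b,C_2,y^t)$ if there exist $m\times n$ matrices $A_1,A_2$ over $R$ such that $a=bA_1$, $y^t=A_2x^t$, and $C_2A_1=A_2C_1$. The relation $\leq$: with the same data, write $(a,C_1,x^t)\leq(b,C_2,y^t)$ if there exist $n\times m$ matrices $A_1,A_2$ over $R$ such that $x^t=A_1y^t$, $b=aA_2$, and $C_1A_2=A_1C_2$. *)

theory Defs
  imports "Jordan_Normal_Form.Matrix" "HOL-Combinatorics.Permutations"
begin

text \<open>
  The sort \<open>{ring, monoid_mult}\<close> is that of associative rings with identity, the zero ring included;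
  the class \<open>ring_1\<close> would add \<open>0 \<noteq> 1\<close>. The library's locale \<open>module\<close> and its constant
  \<open>invertible_mat\<close> need stronger sorts, hence the versions below.
\<close>

locale unital_left_module =
  fixes scale :: "'r::{ring,monoid_mult} \<Rightarrow> 'x::ab_group_add \<Rightarrow> 'x"
  assumes scale_add_right: "scale r (x + y) = scale r x + scale r y"
    and scale_add_left: "scale (r + s) x = scale r x + scale s x"
    and scale_scale: "scale r (scale s x) = scale (r * s) x"
    and scale_one: "scale 1 x = x"

definition row_mult :: "'r::{ring,monoid_mult} vec \<Rightarrow> 'r mat \<Rightarrow> 'r vec" where
  "row_mult a A = vec (dim_col A) (\<lambda>j. a \<bullet> col A j)"

definition mat_act :: "('r::{ring,monoid_mult} \<Rightarrow> 'x::ab_group_add \<Rightarrow> 'x) \<Rightarrow> 'r mat \<Rightarrow> 'x vec \<Rightarrow> 'x vec" where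
  "mat_act scale A x = vec (dim_row A) (\<lambda>i. \<Sum>j\<in>{0..<dim_vec x}. scale (A $$ (i,j)) (x $ j))"

definition inv_mats :: "nat \<Rightarrow> 'r::{ring,monoid_mult} mat set" where
  "inv_mats n = {U \<in> carrier_mat n n. \<exists>V \<in> carrier_mat n n. U * V = 1\<^sub>m n \<and> V * U = 1\<^sub>m n}"

definition perm_mat :: "nat \<Rightarrow> (nat \<Rightarrow> nat) \<Rightarrow> 'r::{ring,monoid_mult} mat" where
  "perm_mat n p = mat n n (\<lambda>(i,j). if i = p j then 1 else 0)"

text \<open>
  Matrices of positive size are meant. An empty matrix in \<open>\<Sigma>\<close> is neither required nor excluded;
  triples, defined below, never contain one.
\<close>

definition multiplicative :: "'r::{ring,monoid_mult} mat set \<Rightarrow> bool" where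
  "multiplicative \<Sigma> \<longleftrightarrow>
     (\<forall>C\<in>\<Sigma>. square_mat C) \<and>
     (\<forall>n>0. \<forall>p. p permutes {..<n} \<longrightarrow> perm_mat n p \<in> \<Sigma>) \<and>
     (\<forall>C\<in>\<Sigma>. \<forall>D\<in>\<Sigma>. dim_col C = dim_row D \<longrightarrow> C * D \<in> \<Sigma>) \<and>
     (\<forall>C\<in>\<Sigma>. \<forall>D\<in>\<Sigma>. \<forall>A\<in>carrier_mat (dim_row C) (dim_col D).
        four_block_mat C A (0\<^sub>m (dim_row D) (dim_col C)) D \<in> \<Sigma>)"

type_synonym ('r, 'x) triple = "'r vec \<times> 'r mat \<times> 'x vec"

definition triples :: "'r::{ring,monoid_mult} mat set \<Rightarrow> ('r, 'x::ab_group_add) triple set" where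
  "triples \<Sigma> = {(a, C, x). \<exists>n>0. a \<in> carrier_vec n \<and> C \<in> \<Sigma> \<inter> carrier_mat n n \<and> x \<in> carrier_vec n}"

fun triple_add :: "('r::{ring,monoid_mult}, 'x::ab_group_add) triple \<Rightarrow> ('r, 'x) triple \<Rightarrow> ('r, 'x) triple"
    (infixl \<open>\<oplus>\<^sub>t\<close> 65) where
  "(a, C, x) \<oplus>\<^sub>t (b, D, y) =
     (a @\<^sub>v b,
      four_block_mat C (0\<^sub>m (dim_row C) (dim_col D)) (0\<^sub>m (dim_row D) (dim_col C)) D,
      x @\<^sub>v y)"

text \<open>
  The relations below read the sizes of the two triples off their first components. They are
  meaningful on elements of \<open>triples \<Sigma>\<close>, and are only used there.
\<close>

fun triple_cong :: "('r::{ring,monoid_mult} \<Rightarrow> 'x::ab_group_add \<Rightarrow> 'x) \<Rightarrow>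
    ('r, 'x) triple \<Rightarrow> ('r, 'x) triple \<Rightarrow> bool" where
  "triple_cong scale (a, C\<^sub>1, x) (b, C\<^sub>2, y) \<longleftrightarrow>
     dim_vec a = dim_vec b \<and>
     (\<exists>U\<^sub>1\<in>inv_mats (dim_vec a). \<exists>U\<^sub>2\<in>inv_mats (dim_vec a).
        a = row_mult b U\<^sub>1 \<and> y = mat_act scale U\<^sub>2 x \<and> C\<^sub>2 * U\<^sub>1 = U\<^sub>2 * C\<^sub>1)"

text \<open>The subsemigroup written \<open>\<Sigma>\<^sup>-\<^sup>1X\<^sub>0\<close>.\<close>

inductive_set zero_triples :: "'r::{ring,monoid_mult} mat set \<Rightarrow> ('r, 'x::ab_group_add) triple set"
  for \<Sigma> :: "'r mat set" where
  zero_left: "(0\<^sub>v n, C, x) \<in> triples \<Sigma> \<Longrightarrow> (0\<^sub>v n, C, x) \<in> zero_triples \<Sigma>"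
| zero_right: "(b, D, 0\<^sub>v n :: 'x vec) \<in> triples \<Sigma> \<Longrightarrow> (b, D, 0\<^sub>v n :: 'x vec) \<in> zero_triples \<Sigma>"
| add: "s \<in> zero_triples \<Sigma> \<Longrightarrow> t \<in> zero_triples \<Sigma> \<Longrightarrow> s \<oplus>\<^sub>t t \<in> zero_triples \<Sigma>"

definition triple_equiv :: "('r::{ring,monoid_mult} \<Rightarrow> 'x::ab_group_add \<Rightarrow> 'x) \<Rightarrow> 'r mat set \<Rightarrow>
    ('r, 'x) triple \<Rightarrow> ('r, 'x) triple \<Rightarrow> bool" where
  "triple_equiv scale \<Sigma> s t \<longleftrightarrow>
     (\<exists>z\<^sub>1\<in>zero_triples \<Sigma>. \<exists>z\<^sub>2\<in>zero_triples \<Sigma>. triple_cong scale (s \<oplus>\<^sub>t z\<^sub>1) (t \<oplus>\<^sub>t z\<^sub>2))"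

text \<open>Neither of the next two relations is the converse of the other.\<close>

fun triple_ge :: "('r::{ring,monoid_mult} \<Rightarrow> 'x::ab_group_add \<Rightarrow> 'x) \<Rightarrow>
    ('r, 'x) triple \<Rightarrow> ('r, 'x) triple \<Rightarrow> bool" where
  "triple_ge scale (a, C\<^sub>1, x) (b, C\<^sub>2, y) \<longleftrightarrow>
     (\<exists>A\<^sub>1\<in>carrier_mat (dim_vec b) (dim_vec a). \<exists>A\<^sub>2\<in>carrier_mat (dim_vec b) (dim_vec a).
        a = row_mult b A\<^sub>1 \<and> y = mat_act scale A\<^sub>2 x \<and> C\<^sub>2 * A\<^sub>1 = A\<^sub>2 * C\<^sub>1)"

fun triple_le :: "('r::{ring,monoid_mult} \<Rightarrow> 'x::ab_group_add \<Rightarrow> 'x) \<Rightarrow>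
    ('r, 'x) triple \<Rightarrow> ('r, 'x) triple \<Rightarrow> bool" where
  "triple_le scale (a, C\<^sub>1, x) (b, C\<^sub>2, y) \<longleftrightarrow>
     (\<exists>A\<^sub>1\<in>carrier_mat (dim_vec a) (dim_vec b). \<exists>A\<^sub>2\<in>carrier_mat (dim_vec a) (dim_vec b).
        x = mat_act scale A\<^sub>1 y \<and> b = row_mult a A\<^sub>2 \<and> C\<^sub>1 * A\<^sub>2 = A\<^sub>1 * C\<^sub>2)"

end

theory Submission
  imports Defs
begin

text \<open>
  The relation \<open>\<ge>\<close> is reflexive, transitive and additive, and \<open>(0, E, z) \<ge> (u, F, 0)\<close> always holds, by
  zero matrices. The relation \<open>\<le>\<close> is reflexive and additive, and \<open>(u, F, 0) \<le> (0, E, z)\<close> always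
  holds. The two relations are linked to congruence by matrices with identity blocks off the diagonal:
  if \<open>(a, C, x) \<ge> (b, D, y)\<close>, then \<open>(a, C, x) + (b, D, 0) \<equiv> (b, D, y) + (0, C, x)\<close>;
  if \<open>(a, C, x) \<le> (b, D, y)\<close>, then \<open>(a, C, x) + (0, D, y) \<ge> (b, D, y) + (a, C, 0)\<close>.
  Zero triples lie between some \<open>(0, E, z)\<close> and some \<open>(u, F, 0)\<close> with respect to \<open>\<ge>\<close>, so each of the
  three conditions amounts to an inequality \<open>s + (0, E, z) \<ge> t + (u, F, 0)\<close>. The sizes of \<open>E\<close> and \<open>F\<close>
  can be made equal by adding \<open>(0, F, 0) \<ge> (0, E, 0)\<close>.
\<close>

section \<open>Matrices and row vectors over a ring with identity\<close>

text \<open>Cuts a sum over the entries of an appended vector at the seam. The block formulas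
  \<open>row_mult_four_block\<close> and \<open>mat_act_four_block\<close> both rest on it.\<close>

lemma sum_atLeast0_add:
  "(\<Sum>j\<in>{0..<p + q}. f j) = (\<Sum>j\<in>{0..<p}. f j) + (\<Sum>j\<in>{0..<q}. f (p + j))"
  for p q :: nat and f :: "nat \<Rightarrow> 'a::comm_monoid_add"
  by (induction q) (auto simp: add.assoc)

text \<open>At this sort \<open>0 = 1\<close> is allowed, so the zero ring is covered. Each entry is
  a sum in which the \<open>if\<close> of the identity matrix keeps a single summand.\<close>

lemma left_one_mat_mult:
  "dim_row A = n \<Longrightarrow> 1\<^sub>m n * A = A" for A :: "'r::{ring,monoid_mult} mat"
  by (intro eq_matI) (auto simp: scalar_prod_def if_distrib[where f = "\<lambda>c. c * _"] cong: if_cong)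

lemma right_one_mat_mult:
  "dim_col A = k \<Longrightarrow> A * 1\<^sub>m k = A" for A :: "'r::{ring,monoid_mult} mat"
  by (intro eq_matI) (auto simp: scalar_prod_def if_distrib[where f = "\<lambda>c. _ * c"] cong: if_cong)

lemma row_mult_index:
  "j < dim_col A \<Longrightarrow> row_mult a A $ j = (\<Sum>i\<in>{0..<dim_row A}. a $ i * A $$ (i, j))"
  by (simp add: row_mult_def scalar_prod_def)

lemma dim_row_mult [simp]: "dim_vec (row_mult a A) = dim_col A"
  by (simp add: row_mult_def)

lemma row_mult_carrier [simp]: "A \<in> carrier_mat n k \<Longrightarrow> row_mult a A \<in> carrier_vec k"
  by (simp add: row_mult_def)

lemma row_mult_assoc:
  assumes "A \<in> carrier_mat n k" "B \<in> carrier_mat k l"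
  shows "row_mult (row_mult a A) B = row_mult a (A * B)"
proof (rule eq_vecI)
  fix j assume "j < dim_vec (row_mult a (A * B))"
  then have j: "j < l" using assms by simp
  have "row_mult (row_mult a A) B $ j
      = (\<Sum>i\<in>{0..<k}. \<Sum>h\<in>{0..<n}. a $ h * A $$ (h, i) * B $$ (i, j))"
    using assms j by (simp add: row_mult_index sum_distrib_right)
  also have "\<dots> = (\<Sum>h\<in>{0..<n}. \<Sum>i\<in>{0..<k}. a $ h * A $$ (h, i) * B $$ (i, j))"
    by (rule sum.swap)
  also have "\<dots> = row_mult a (A * B) $ j"
    using assms j by (simp add: row_mult_index sum_distrib_left scalar_prod_def mult.assoc)
  finally show "row_mult (row_mult a A) B $ j = row_mult a (A * B) $ j" .
qed (use assms in simp)

lemma row_mult_one [simp]: "a \<in> carrier_vec n \<Longrightarrow> row_mult a (1\<^sub>m n) = a"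
  by (intro eq_vecI) (auto simp: row_mult_index if_distrib[where f = "\<lambda>c. _ * c"] cong: if_cong)

lemma row_mult_zero_mat [simp]: "row_mult a (0\<^sub>m n k) = 0\<^sub>v k"
  by (intro eq_vecI) (auto simp: row_mult_index)

lemma row_mult_zero_vec [simp]: "A \<in> carrier_mat n k \<Longrightarrow> row_mult (0\<^sub>v n) A = 0\<^sub>v k"
  by (intro eq_vecI) (auto simp: row_mult_index)

lemma row_mult_uminus:
  "A \<in> carrier_mat n k \<Longrightarrow> row_mult a (- A) = - row_mult a A"
  by (intro eq_vecI) (auto simp: row_mult_index sum_negf)

lemma row_mult_four_block:
  assumes "a \<in> carrier_vec n" "b \<in> carrier_vec m"
    and "A \<in> carrier_mat n k" "B \<in> carrier_mat n l" "C \<in> carrier_mat m k" "D \<in> carrier_mat m l"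
  shows "row_mult (a @\<^sub>v b) (four_block_mat A B C D)
    = (row_mult a A + row_mult b C) @\<^sub>v (row_mult a B + row_mult b D)"
  using assms by (intro eq_vecI) (auto simp: row_mult_index sum_atLeast0_add)

lemma dim_mat_act [simp]: "dim_vec (mat_act scale A x) = dim_row A"
  by (simp add: mat_act_def)

lemma mat_act_index:
  "i < dim_row A \<Longrightarrow> mat_act scale A x $ i = (\<Sum>j\<in>{0..<dim_vec x}. scale (A $$ (i, j)) (x $ j))"
  by (simp add: mat_act_def)

lemma uminus_zero_mat: "- 0\<^sub>m n k = (0\<^sub>m n k :: 'a::group_add mat)"
  by (intro eq_matI) auto

text \<open>However far \<open>A\<close> is from being invertible, or even square, the two identity
  blocks make the bordered matrix invertible. This turns the arbitrary matrices of
  \<open>\<ge>\<close> into the invertible ones of a congruence.\<close>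

lemma off_diagonal_one_mats_inverse:
  fixes A :: "'r::{ring,monoid_mult} mat"
  assumes A: "A \<in> carrier_mat m n"
  shows "four_block_mat A (1\<^sub>m m) (1\<^sub>m n) (0\<^sub>m n m) \<in> inv_mats (m + n)"
proof -
  let ?U = "four_block_mat A (1\<^sub>m m) (1\<^sub>m n) (0\<^sub>m n m)"
  \<comment> \<open>The inverse, found by solving for the blocks. In both products the only entry
    that is not immediate is \<open>A + - A\<close>.\<close>
  let ?V = "four_block_mat (0\<^sub>m n m) (1\<^sub>m n) (1\<^sub>m m) (- A)"
  have A': "A + - A = 0\<^sub>m m n"
    using A by (intro eq_matI) auto
  have "?U * ?V = four_block_mat (A * 0\<^sub>m n m + 1\<^sub>m m * 1\<^sub>m m) (A * 1\<^sub>m n + 1\<^sub>m m * (- A))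
     (1\<^sub>m n * 0\<^sub>m n m + 0\<^sub>m n m * 1\<^sub>m m) (1\<^sub>m n * 1\<^sub>m n + 0\<^sub>m n m * (- A))"
    using A by (intro mult_four_block_mat) auto
  then have UV: "?U * ?V = 1\<^sub>m (m + n)"
    using A by (simp add: left_one_mat_mult right_one_mat_mult uminus_zero_mat A')
  have "?V * ?U = four_block_mat (0\<^sub>m n m * A + 1\<^sub>m n * 1\<^sub>m n) (0\<^sub>m n m * 1\<^sub>m m + 1\<^sub>m n * 0\<^sub>m n m)
     (1\<^sub>m m * A + (- A) * 1\<^sub>m n) (1\<^sub>m m * 1\<^sub>m m + (- A) * 0\<^sub>m n m)"
    using A by (intro mult_four_block_mat) auto
  then have VU: "?V * ?U = 1\<^sub>m (n + m)"
    using A by (simp add: left_one_mat_mult right_one_mat_mult A')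
  have U: "?U \<in> carrier_mat (m + n) (m + n)"
    using A by (intro carrier_matI) simp_all
  have V: "?V \<in> carrier_mat (m + n) (m + n)"
    using A by (intro carrier_matI) simp_all
  show ?thesis
    using U V UV VU[unfolded add.commute[of n m]] by (simp add: inv_mats_def) blast
qed

section \<open>Triples, their sizes and their sums\<close>

text \<open>Weaker than membership in \<open>triples \<Sigma>\<close>: the size may be 0 and
  \<open>C\<close> need not lie in \<open>\<Sigma>\<close>. This admits the triple of size 0, which
  is neutral for sums.\<close>

fun sized :: "nat \<Rightarrow> ('r, 'x) triple \<Rightarrow> bool" where
  "sized n (a, C, x) \<longleftrightarrow> a \<in> carrier_vec n \<and> C \<in> carrier_mat n n \<and> x \<in> carrier_vec n"

lemma append_vec_assoc: "(a @\<^sub>v b) @\<^sub>v c = a @\<^sub>v (b @\<^sub>v c)"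
  by (intro eq_vecI) auto

text \<open>Associativity is an equality here, whereas commutativity holds only up to congruence.
  The later sums are arranged so that regrouping by this equality is enough.\<close>

lemma triple_add_assoc: "(r \<oplus>\<^sub>t s) \<oplus>\<^sub>t t = r \<oplus>\<^sub>t (s \<oplus>\<^sub>t t)"
proof (cases r; cases s; cases t)
  fix a C x b D y c E z
  assume "r = (a, C, x)" "s = (b, D, y)" "t = (c, E, z)"
  then show ?thesis
    using assoc_four_block_mat[of C D E] by (simp add: append_vec_assoc)
qed

lemma triple_add_empty: "sized n s \<Longrightarrow> s \<oplus>\<^sub>t (0\<^sub>v 0, 0\<^sub>m 0 0, 0\<^sub>v 0) = s"
  by (cases s) (auto intro!: eq_matI)

lemma zero_append_zero [simp]: "0\<^sub>v n @\<^sub>v 0\<^sub>v m = 0\<^sub>v (n + m)"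
  by (intro eq_vecI) auto

text \<open>The closure of \<open>\<Sigma>\<close> under block triangular matrices, with the upper
  right block taken to be zero.\<close>

lemma multiplicative_direct_sum:
  assumes "multiplicative \<Sigma>" "C \<in> \<Sigma> \<inter> carrier_mat n n" "D \<in> \<Sigma> \<inter> carrier_mat m m"
  shows "four_block_mat C (0\<^sub>m n m) (0\<^sub>m m n) D \<in> \<Sigma> \<inter> carrier_mat (n + m) (n + m)"
proof -
  have dims: "dim_row C = n" "dim_col C = n" "dim_row D = m" "dim_col D = m"
    using assms by auto
  have "\<forall>A\<in>carrier_mat (dim_row C) (dim_col D).
      four_block_mat C A (0\<^sub>m (dim_row D) (dim_col C)) D \<in> \<Sigma>"
    using assms unfolding multiplicative_def by blast
  then show ?thesis using assms(2,3) by (simp add: dims)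
qed

lemma triplesE:
  assumes "s \<in> triples \<Sigma>"
  obtains n a C x where "s = (a, C, x)" "n > 0" "sized n (a, C, x)" "C \<in> \<Sigma>"
  using assms unfolding triples_def by auto

lemma triples_sizedE:
  assumes "s \<in> triples \<Sigma>"
  obtains n where "sized n s"
  using assms by (metis triplesE)

lemma triples_add:
  assumes \<Sigma>: "multiplicative \<Sigma>" and s: "s \<in> triples \<Sigma>" and t: "t \<in> triples \<Sigma>"
  shows "s \<oplus>\<^sub>t t \<in> triples \<Sigma>"
proof -
  obtain n a C x where s: "s = (a, C, x)" "n > 0" "sized n (a, C, x)" "C \<in> \<Sigma>"
    using s by (rule triplesE)
  obtain m b D y where t: "t = (b, D, y)" "m > 0" "sized m (b, D, y)" "D \<in> \<Sigma>"
    using t by (rule triplesE)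
  have CD: "C \<in> \<Sigma> \<inter> carrier_mat n n" "D \<in> \<Sigma> \<inter> carrier_mat m m"
    using s t by simp_all
  have "s \<oplus>\<^sub>t t = (a @\<^sub>v b, four_block_mat C (0\<^sub>m n m) (0\<^sub>m m n) D, x @\<^sub>v y)"
    using s(1) t(1) CD by auto
  moreover have "a @\<^sub>v b \<in> carrier_vec (n + m)" "x @\<^sub>v y \<in> carrier_vec (n + m)"
    using s(3) t(3) by simp_all
  ultimately show ?thesis
    using multiplicative_direct_sum[OF \<Sigma> CD] s(2) unfolding triples_def by auto
qed

section \<open>The two kinds of generating zero triples\<close>

text \<open>The generators of \<open>zero_triples \<Sigma>\<close> are split into two families,
  \<open>left_zeros\<close> and \<open>right_zeros\<close>. Each family is closed under sums, and
  every member of the first is \<open>\<ge>\<close> every member of the second.\<close>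

definition left_zeros :: "'r::{ring,monoid_mult} mat set \<Rightarrow> ('r, 'x::ab_group_add) triple set" where
  "left_zeros \<Sigma> = {(0\<^sub>v n, E, z) | n E z. (0\<^sub>v n, E, z) \<in> triples \<Sigma>}"

definition right_zeros :: "'r::{ring,monoid_mult} mat set \<Rightarrow> ('r, 'x::ab_group_add) triple set" where
  "right_zeros \<Sigma> = {(u, F, 0\<^sub>v n) | u F n. (u, F, 0\<^sub>v n :: 'x vec) \<in> triples \<Sigma>}"

lemma zero_vec_in_carrier_iff [simp]: "0\<^sub>v n \<in> carrier_vec m \<longleftrightarrow> n = m"
  unfolding carrier_vec_def by simp

lemma left_zerosI:
  assumes "n > 0" "E \<in> \<Sigma>" "sized n (0\<^sub>v n, E, z)"
  shows "(0\<^sub>v n, E, z) \<in> left_zeros \<Sigma>"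
proof -
  have "(0\<^sub>v n, E, z) \<in> triples \<Sigma>"
    using assms by (simp add: triples_def)
  then show ?thesis
    unfolding left_zeros_def by blast
qed

lemma right_zerosI:
  assumes "n > 0" "F \<in> \<Sigma>" "sized n (u, F, 0\<^sub>v n :: 'x::ab_group_add vec)"
  shows "(u, F, 0\<^sub>v n :: 'x vec) \<in> right_zeros \<Sigma>"
proof -
  have "(u, F, 0\<^sub>v n :: 'x vec) \<in> triples \<Sigma>"
    using assms by (simp add: triples_def)
  then show ?thesis
    unfolding right_zeros_def by blast
qed

lemma left_zerosE:
  assumes "p \<in> left_zeros \<Sigma>"
  obtains n E z where "p = (0\<^sub>v n, E, z)" "n > 0" "E \<in> \<Sigma>" "sized n (0\<^sub>v n, E, z)"
  using assms unfolding left_zeros_def triples_def by auto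

lemma right_zerosE:
  fixes q :: "('r::{ring,monoid_mult}, 'x::ab_group_add) triple"
  assumes "q \<in> right_zeros \<Sigma>"
  obtains n u F where "q = (u, F, 0\<^sub>v n)" "n > 0" "F \<in> \<Sigma>" "sized n (u, F, 0\<^sub>v n :: 'x vec)"
  using assms unfolding right_zeros_def triples_def by auto

lemma left_zeros_subset: "left_zeros \<Sigma> \<subseteq> triples \<Sigma>"
  unfolding left_zeros_def by blast

lemma right_zeros_subset: "right_zeros \<Sigma> \<subseteq> triples \<Sigma>"
  unfolding right_zeros_def by blast

lemma left_zeros_zero_triples: "left_zeros \<Sigma> \<subseteq> zero_triples \<Sigma>"
  unfolding left_zeros_def by (blast intro: zero_triples.zero_left)

lemma right_zeros_zero_triples: "right_zeros \<Sigma> \<subseteq> zero_triples \<Sigma>"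
  unfolding right_zeros_def by (blast intro: zero_triples.zero_right)

lemma zero_triples_subset:
  assumes "multiplicative \<Sigma>"
  shows "zero_triples \<Sigma> \<subseteq> (triples \<Sigma> :: ('r::{ring,monoid_mult}, 'x::ab_group_add) triple set)"
proof
  fix r :: "('r, 'x) triple"
  assume "r \<in> zero_triples \<Sigma>"
  then show "r \<in> triples \<Sigma>"
    by induction (auto intro: triples_add[OF assms] simp del: triple_add.simps)
qed

lemma left_zeros_add:
  assumes "multiplicative \<Sigma>" "p \<in> left_zeros \<Sigma>" "p' \<in> left_zeros \<Sigma>"
  shows "p \<oplus>\<^sub>t p' \<in> left_zeros \<Sigma>"
proof -
  have "p \<oplus>\<^sub>t p' \<in> triples \<Sigma>"
    using triples_add assms left_zeros_subset by blast
  moreover have "\<exists>n E z. p \<oplus>\<^sub>t p' = (0\<^sub>v n, E, z)"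
    using assms(2,3) unfolding left_zeros_def by fastforce
  ultimately show ?thesis
    unfolding left_zeros_def by auto
qed

lemma right_zeros_add:
  assumes "multiplicative \<Sigma>" "q \<in> right_zeros \<Sigma>" "q' \<in> right_zeros \<Sigma>"
  shows "q \<oplus>\<^sub>t q' \<in> right_zeros \<Sigma>"
proof -
  have "q \<oplus>\<^sub>t q' \<in> triples \<Sigma>"
    using triples_add assms right_zeros_subset by blast
  moreover have "\<exists>u F n. q \<oplus>\<^sub>t q' = (u, F, 0\<^sub>v n)"
    using assms(2,3) unfolding right_zeros_def by fastforce
  ultimately show ?thesis
    unfolding right_zeros_def by auto
qed

section \<open>Handling the matrices behind the relations\<close>

text \<open>The blocks may be rectangular, so this verifies the block diagonal witnesses for sums of
  triples in both \<open>triple_ge_add\<close> and \<open>triple_le_add\<close>.\<close>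

lemma mult_direct_sums:
  fixes A :: "'r::{ring,monoid_mult} mat"
  assumes "A \<in> carrier_mat p q" "B \<in> carrier_mat q r" "C \<in> carrier_mat k l" "D \<in> carrier_mat l h"
  shows "four_block_mat A (0\<^sub>m p l) (0\<^sub>m k q) C * four_block_mat B (0\<^sub>m q h) (0\<^sub>m l r) D
    = four_block_mat (A * B) (0\<^sub>m p h) (0\<^sub>m k r) (C * D)"
  using assms by (subst mult_four_block_mat[of _ p q _ l _ k _ _ r _ h]) auto

text \<open>This rule and the next three name the sizes \<open>n\<close> and \<open>m\<close>
  explicitly, in place of the terms \<open>dim_vec a\<close> and \<open>dim_vec b\<close> in the
  definitions.\<close>

lemma triple_geI:
  assumes "a \<in> carrier_vec n" "b \<in> carrier_vec m" "A\<^sub>1 \<in> carrier_mat m n" "A\<^sub>2 \<in> carrier_mat m n"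
    and "a = row_mult b A\<^sub>1" "y = mat_act scale A\<^sub>2 x" "D * A\<^sub>1 = A\<^sub>2 * C"
  shows "triple_ge scale (a, C, x) (b, D, y)"
  using assms by auto

lemma triple_geE:
  assumes "triple_ge scale (a, C, x) (b, D, y)" "a \<in> carrier_vec n" "b \<in> carrier_vec m"
  obtains A\<^sub>1 A\<^sub>2 where "A\<^sub>1 \<in> carrier_mat m n" "A\<^sub>2 \<in> carrier_mat m n"
    "a = row_mult b A\<^sub>1" "y = mat_act scale A\<^sub>2 x" "D * A\<^sub>1 = A\<^sub>2 * C"
  using assms by auto

lemma triple_leI:
  assumes "a \<in> carrier_vec n" "b \<in> carrier_vec m" "A\<^sub>1 \<in> carrier_mat n m" "A\<^sub>2 \<in> carrier_mat n m"
    and "x = mat_act scale A\<^sub>1 y" "b = row_mult a A\<^sub>2" "C * A\<^sub>2 = A\<^sub>1 * D"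
  shows "triple_le scale (a, C, x) (b, D, y)"
  using assms by auto

lemma triple_leE:
  assumes "triple_le scale (a, C, x) (b, D, y)" "a \<in> carrier_vec n" "b \<in> carrier_vec m"
  obtains A\<^sub>1 A\<^sub>2 where "A\<^sub>1 \<in> carrier_mat n m" "A\<^sub>2 \<in> carrier_mat n m"
    "x = mat_act scale A\<^sub>1 y" "b = row_mult a A\<^sub>2" "C * A\<^sub>2 = A\<^sub>1 * D"
  using assms by auto

text \<open>The invertible matrices of the congruence serve unchanged as witnesses. The equality of
  the two sizes puts them into the carrier that \<open>\<ge>\<close> asks for.\<close>

lemma triple_cong_imp_ge:
  fixes scale :: "'r::{ring,monoid_mult} \<Rightarrow> 'x::ab_group_add \<Rightarrow> 'x"
  assumes "triple_cong scale s t"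
  shows "triple_ge scale s t"
proof (cases s; cases t)
  fix a C x b D y
  assume [simp]: "s = (a, C, x)" "t = (b, D, y)"
  have "dim_vec a = dim_vec b" using assms by simp
  moreover have "inv_mats (dim_vec a) \<subseteq> (carrier_mat (dim_vec a) (dim_vec a) :: 'r mat set)"
    by (auto simp: inv_mats_def)
  ultimately show ?thesis using assms by fastforce
qed

section \<open>Action of matrices on columns over the module\<close>

context unital_left_module
begin

lemma scale_zero_left [simp]: "scale 0 x = 0"
  using scale_add_left[of 0 0 x] by simp

lemma scale_zero_right [simp]: "scale r 0 = 0"
  using scale_add_right[of r 0 0] by simp

lemma scale_minus_left: "scale (- r) x = - scale r x"
  using scale_add_left[of "- r" r x] by (simp add: eq_neg_iff_add_eq_0)

lemma scale_sum_right: "scale r (\<Sum>i\<in>I. f i) = (\<Sum>i\<in>I. scale r (f i))"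
  by (induction I rule: infinite_finite_induct) (auto simp: scale_add_right)

lemma scale_sum_left: "scale (\<Sum>i\<in>I. f i) x = (\<Sum>i\<in>I. scale (f i) x)"
  by (induction I rule: infinite_finite_induct) (auto simp: scale_add_left)

lemma mat_act_assoc:
  assumes "A \<in> carrier_mat n k" "B \<in> carrier_mat k l" "x \<in> carrier_vec l"
  shows "mat_act scale A (mat_act scale B x) = mat_act scale (A * B) x"
proof (rule eq_vecI)
  fix i assume "i < dim_vec (mat_act scale (A * B) x)"
  then have i: "i < n" using assms by simp
  have "mat_act scale A (mat_act scale B x) $ i
      = (\<Sum>j\<in>{0..<k}. \<Sum>h\<in>{0..<l}. scale (A $$ (i, j) * B $$ (j, h)) (x $ h))"
    using assms i by (simp add: mat_act_index scale_sum_right scale_scale)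
  also have "\<dots> = (\<Sum>h\<in>{0..<l}. \<Sum>j\<in>{0..<k}. scale (A $$ (i, j) * B $$ (j, h)) (x $ h))"
    by (rule sum.swap)
  also have "\<dots> = mat_act scale (A * B) x $ i"
    using assms i by (simp add: mat_act_index scale_sum_left scalar_prod_def)
  finally show "mat_act scale A (mat_act scale B x) $ i = mat_act scale (A * B) x $ i" .
qed (use assms in simp)

lemma mat_act_one [simp]: "x \<in> carrier_vec n \<Longrightarrow> mat_act scale (1\<^sub>m n) x = x"
  by (intro eq_vecI)
    (auto simp: mat_act_index if_distrib[where f = "\<lambda>c. scale c _"] scale_one cong: if_cong)

lemma mat_act_zero_mat [simp]: "x \<in> carrier_vec k \<Longrightarrow> mat_act scale (0\<^sub>m n k) x = 0\<^sub>v n"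
  by (intro eq_vecI) (auto simp: mat_act_index)

lemma mat_act_zero_vec [simp]: "A \<in> carrier_mat n k \<Longrightarrow> mat_act scale A (0\<^sub>v k) = 0\<^sub>v n"
  by (intro eq_vecI) (auto simp: mat_act_index)

lemma mat_act_uminus:
  "A \<in> carrier_mat n k \<Longrightarrow> x \<in> carrier_vec k \<Longrightarrow> mat_act scale (- A) x = - mat_act scale A x"
  by (intro eq_vecI) (auto simp: mat_act_index scale_minus_left sum_negf)

lemma mat_act_four_block:
  assumes "x \<in> carrier_vec k" "y \<in> carrier_vec l"
    and "A \<in> carrier_mat n k" "B \<in> carrier_mat n l" "C \<in> carrier_mat m k" "D \<in> carrier_mat m l"
  shows "mat_act scale (four_block_mat A B C D) (x @\<^sub>v y)
    = (mat_act scale A x + mat_act scale B y) @\<^sub>v (mat_act scale C x + mat_act scale D y)"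
  using assms by (intro eq_vecI) (auto simp: mat_act_index sum_atLeast0_add)

section \<open>Reflexivity, transitivity and additivity\<close>

lemma triple_ge_refl: "sized n s \<Longrightarrow> triple_ge scale s s"
  by (cases s) (auto intro!: triple_geI[of _ n _ n "1\<^sub>m n" "1\<^sub>m n"]
      simp: left_one_mat_mult right_one_mat_mult simp del: triple_ge.simps)

lemma triple_le_refl: "sized n s \<Longrightarrow> triple_le scale s s"
  by (cases s) (auto intro!: triple_leI[of _ n _ n "1\<^sub>m n" "1\<^sub>m n"]
      simp: left_one_mat_mult right_one_mat_mult simp del: triple_le.simps)

lemma triple_ge_trans:
  assumes "sized n r" "sized m s" "sized k t" "triple_ge scale r s" "triple_ge scale s t"
  shows "triple_ge scale r t"
proof (cases r; cases s; cases t)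
  fix a C x b D y c E z
  assume [simp]: "r = (a, C, x)" "s = (b, D, y)" "t = (c, E, z)"
  have car: "a \<in> carrier_vec n" "C \<in> carrier_mat n n" "x \<in> carrier_vec n"
    "b \<in> carrier_vec m" "D \<in> carrier_mat m m" "c \<in> carrier_vec k" "E \<in> carrier_mat k k"
    using assms by auto
  obtain A\<^sub>1 A\<^sub>2 where A: "A\<^sub>1 \<in> carrier_mat m n" "A\<^sub>2 \<in> carrier_mat m n"
    "a = row_mult b A\<^sub>1" "y = mat_act scale A\<^sub>2 x" "D * A\<^sub>1 = A\<^sub>2 * C"
    using triple_geE[of scale a C x b D y n m] assms(4) car by auto
  obtain B\<^sub>1 B\<^sub>2 where B: "B\<^sub>1 \<in> carrier_mat k m" "B\<^sub>2 \<in> carrier_mat k m"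
    "b = row_mult c B\<^sub>1" "z = mat_act scale B\<^sub>2 y" "E * B\<^sub>1 = B\<^sub>2 * D"
    using triple_geE[of scale b D y c E z m k] assms(5) car by auto
  \<comment> \<open>The witnesses for the composite are the products
    \<open>B\<^sub>1 * A\<^sub>1\<close> and \<open>B\<^sub>2 * A\<^sub>2\<close>. The chain moves
    \<open>E\<close> past \<open>B\<^sub>1\<close> and the resulting \<open>D\<close> past
    \<open>A\<^sub>1\<close>.\<close>
  have "E * (B\<^sub>1 * A\<^sub>1) = E * B\<^sub>1 * A\<^sub>1"
    using A B car by (intro assoc_mult_mat[symmetric, of _ k k _ m _ n]) auto
  also have "\<dots> = B\<^sub>2 * D * A\<^sub>1"
    by (simp only: B(5))
  also have "\<dots> = B\<^sub>2 * (D * A\<^sub>1)"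
    using A B car by (intro assoc_mult_mat[of _ k m _ m _ n]) auto
  also have "\<dots> = B\<^sub>2 * (A\<^sub>2 * C)"
    by (simp only: A(5))
  also have "\<dots> = B\<^sub>2 * A\<^sub>2 * C"
    using A B car by (intro assoc_mult_mat[symmetric, of _ k m _ n _ n]) auto
  finally have "triple_ge scale (a, C, x) (c, E, z)"
    using A B car by (intro triple_geI[of _ n _ k "B\<^sub>1 * A\<^sub>1" "B\<^sub>2 * A\<^sub>2"])
      (auto simp: row_mult_assoc mat_act_assoc)
  then show ?thesis by simp
qed

lemma triple_ge_add:
  assumes "sized n s" "sized m s'" "sized k t" "sized l t'"
    and "triple_ge scale s s'" "triple_ge scale t t'"
  shows "triple_ge scale (s \<oplus>\<^sub>t t) (s' \<oplus>\<^sub>t t')"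
proof (cases s; cases s'; cases t; cases t')
  fix a C x a' C' x' b D y b' D' y'
  assume [simp]: "s = (a, C, x)" "s' = (a', C', x')" "t = (b, D, y)" "t' = (b', D', y')"
  have car: "a \<in> carrier_vec n" "C \<in> carrier_mat n n" "x \<in> carrier_vec n"
    "a' \<in> carrier_vec m" "C' \<in> carrier_mat m m" "x' \<in> carrier_vec m"
    "b \<in> carrier_vec k" "D \<in> carrier_mat k k" "y \<in> carrier_vec k"
    "b' \<in> carrier_vec l" "D' \<in> carrier_mat l l" "y' \<in> carrier_vec l"
    using assms by auto
  obtain A\<^sub>1 A\<^sub>2 where A: "A\<^sub>1 \<in> carrier_mat m n" "A\<^sub>2 \<in> carrier_mat m n"
    "a = row_mult a' A\<^sub>1" "x' = mat_act scale A\<^sub>2 x" "C' * A\<^sub>1 = A\<^sub>2 * C"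
    using triple_geE[of scale a C x a' C' x' n m] assms(5) car by auto
  obtain B\<^sub>1 B\<^sub>2 where B: "B\<^sub>1 \<in> carrier_mat l k" "B\<^sub>2 \<in> carrier_mat l k"
    "b = row_mult b' B\<^sub>1" "y' = mat_act scale B\<^sub>2 y" "D' * B\<^sub>1 = B\<^sub>2 * D"
    using triple_geE[of scale b D y b' D' y' k l] assms(6) car by auto
  have "triple_ge scale (a @\<^sub>v b, four_block_mat C (0\<^sub>m n k) (0\<^sub>m k n) D, x @\<^sub>v y)
      (a' @\<^sub>v b', four_block_mat C' (0\<^sub>m m l) (0\<^sub>m l m) D', x' @\<^sub>v y')"
  proof (rule triple_geI[of _ "n + k" _ "m + l"
        "four_block_mat A\<^sub>1 (0\<^sub>m m k) (0\<^sub>m l n) B\<^sub>1" "four_block_mat A\<^sub>2 (0\<^sub>m m k) (0\<^sub>m l n) B\<^sub>2"])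
    show "a @\<^sub>v b = row_mult (a' @\<^sub>v b') (four_block_mat A\<^sub>1 (0\<^sub>m m k) (0\<^sub>m l n) B\<^sub>1)"
      using A B car by (subst row_mult_four_block) auto
    show "x' @\<^sub>v y' = mat_act scale (four_block_mat A\<^sub>2 (0\<^sub>m m k) (0\<^sub>m l n) B\<^sub>2) (x @\<^sub>v y)"
      using A B car by (subst mat_act_four_block) auto
  qed (use A B car in \<open>auto simp: mult_direct_sums\<close>)
  then show ?thesis using car by simp
qed

lemma triple_le_add:
  assumes "sized n s" "sized m s'" "sized k t" "sized l t'"
    and "triple_le scale s s'" "triple_le scale t t'"
  shows "triple_le scale (s \<oplus>\<^sub>t t) (s' \<oplus>\<^sub>t t')"
proof (cases s; cases s'; cases t; cases t')
  fix a C x a' C' x' b D y b' D' y'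
  assume [simp]: "s = (a, C, x)" "s' = (a', C', x')" "t = (b, D, y)" "t' = (b', D', y')"
  have car: "a \<in> carrier_vec n" "C \<in> carrier_mat n n" "x \<in> carrier_vec n"
    "a' \<in> carrier_vec m" "C' \<in> carrier_mat m m" "x' \<in> carrier_vec m"
    "b \<in> carrier_vec k" "D \<in> carrier_mat k k" "y \<in> carrier_vec k"
    "b' \<in> carrier_vec l" "D' \<in> carrier_mat l l" "y' \<in> carrier_vec l"
    using assms by auto
  obtain A\<^sub>1 A\<^sub>2 where A: "A\<^sub>1 \<in> carrier_mat n m" "A\<^sub>2 \<in> carrier_mat n m"
    "x = mat_act scale A\<^sub>1 x'" "a' = row_mult a A\<^sub>2" "C * A\<^sub>2 = A\<^sub>1 * C'"
    using triple_leE[of scale a C x a' C' x' n m] assms(5) car by auto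
  obtain B\<^sub>1 B\<^sub>2 where B: "B\<^sub>1 \<in> carrier_mat k l" "B\<^sub>2 \<in> carrier_mat k l"
    "y = mat_act scale B\<^sub>1 y'" "b' = row_mult b B\<^sub>2" "D * B\<^sub>2 = B\<^sub>1 * D'"
    using triple_leE[of scale b D y b' D' y' k l] assms(6) car by auto
  have "triple_le scale (a @\<^sub>v b, four_block_mat C (0\<^sub>m n k) (0\<^sub>m k n) D, x @\<^sub>v y)
      (a' @\<^sub>v b', four_block_mat C' (0\<^sub>m m l) (0\<^sub>m l m) D', x' @\<^sub>v y')"
  proof (rule triple_leI[of _ "n + k" _ "m + l"
        "four_block_mat A\<^sub>1 (0\<^sub>m n l) (0\<^sub>m k m) B\<^sub>1" "four_block_mat A\<^sub>2 (0\<^sub>m n l) (0\<^sub>m k m) B\<^sub>2"])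
    show "a' @\<^sub>v b' = row_mult (a @\<^sub>v b) (four_block_mat A\<^sub>2 (0\<^sub>m n l) (0\<^sub>m k m) B\<^sub>2)"
      using A B car by (subst row_mult_four_block) auto
    show "x @\<^sub>v y = mat_act scale (four_block_mat A\<^sub>1 (0\<^sub>m n l) (0\<^sub>m k m) B\<^sub>1) (x' @\<^sub>v y')"
      using A B car by (subst mat_act_four_block) auto
  qed (use A B car in \<open>auto simp: mult_direct_sums\<close>)
  then show ?thesis using car by simp
qed

lemma zero_left_ge_zero_right:
  assumes "sized n (0\<^sub>v n, E, z)" "sized m (u, F, 0\<^sub>v m :: 'x vec)"
  shows "triple_ge scale (0\<^sub>v n, E, z) (u, F, 0\<^sub>v m)"
  using assms by (intro triple_geI[of _ n _ m "0\<^sub>m m n" "0\<^sub>m m n"]) auto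

lemma zero_right_le_zero_left:
  assumes "sized n (0\<^sub>v n, E, z)" "sized m (u, F, 0\<^sub>v m :: 'x vec)"
  shows "triple_le scale (u, F, 0\<^sub>v m) (0\<^sub>v n, E, z)"
  using assms by (intro triple_leI[of _ m _ n "0\<^sub>m m n" "0\<^sub>m m n"]) auto

section \<open>The relations on triples over \<open>\<Sigma>\<close>\<close>

lemma triples_ge_refl: "s \<in> triples \<Sigma> \<Longrightarrow> triple_ge scale s s"
  by (erule triples_sizedE) (rule triple_ge_refl)

lemma triples_le_refl: "s \<in> triples \<Sigma> \<Longrightarrow> triple_le scale s s"
  by (erule triples_sizedE) (rule triple_le_refl)

lemma triples_ge_trans:
  assumes "r \<in> triples \<Sigma>" "s \<in> triples \<Sigma>" "t \<in> triples \<Sigma>" "triple_ge scale r s" "triple_ge scale s t"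
  shows "triple_ge scale r t"
  using assms by (elim triples_sizedE) (rule triple_ge_trans)

lemma triples_ge_add:
  assumes "s \<in> triples \<Sigma>" "s' \<in> triples \<Sigma>" "t \<in> triples \<Sigma>" "t' \<in> triples \<Sigma>"
    and "triple_ge scale s s'" "triple_ge scale t t'"
  shows "triple_ge scale (s \<oplus>\<^sub>t t) (s' \<oplus>\<^sub>t t')"
  using assms by (elim triples_sizedE) (rule triple_ge_add)

lemma triples_le_add:
  assumes "s \<in> triples \<Sigma>" "s' \<in> triples \<Sigma>" "t \<in> triples \<Sigma>" "t' \<in> triples \<Sigma>"
    and "triple_le scale s s'" "triple_le scale t t'"
  shows "triple_le scale (s \<oplus>\<^sub>t t) (s' \<oplus>\<^sub>t t')"
  using assms by (elim triples_sizedE) (rule triple_le_add)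

lemma left_zero_ge_right_zero:
  assumes "p \<in> left_zeros \<Sigma>" "q \<in> right_zeros \<Sigma>"
  shows "triple_ge scale p q"
proof -
  obtain n E z where p: "p = (0\<^sub>v n, E, z)" "sized n (0\<^sub>v n, E, z)"
    using assms(1) by (rule left_zerosE)
  obtain m u F where q: "q = (u, F, 0\<^sub>v m)" "sized m (u, F, 0\<^sub>v m :: 'x vec)"
    using assms(2) by (rule right_zerosE)
  show ?thesis
    unfolding p(1) q(1) by (rule zero_left_ge_zero_right[OF p(2) q(2)])
qed

text \<open>Both lemmas add the inequality between a zero triple and the triple of size \<open>0\<close>.\<close>

lemma triple_le_add_left_zero:
  assumes "s \<in> triples \<Sigma>" "p \<in> left_zeros \<Sigma>"
  shows "triple_le scale s (s \<oplus>\<^sub>t p)"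
proof -
  let ?o = "(0\<^sub>v 0, 0\<^sub>m 0 0, 0\<^sub>v 0) :: ('r, 'x) triple"
  obtain n where s: "sized n s"
    using assms(1) by (rule triples_sizedE)
  obtain m E z where p: "p = (0\<^sub>v m, E, z)" "sized m (0\<^sub>v m, E, z)"
    using assms(2) by (rule left_zerosE)
  have o: "sized 0 ?o" by simp
  have "triple_le scale (s \<oplus>\<^sub>t ?o) (s \<oplus>\<^sub>t p)"
    unfolding p(1)
    by (rule triple_le_add[OF s s o p(2) triple_le_refl[OF s] zero_right_le_zero_left[OF p(2) o]])
  then show ?thesis
    unfolding triple_add_empty[OF s] .
qed

lemma add_right_zero_triple_le:
  assumes "s \<in> triples \<Sigma>" "q \<in> right_zeros \<Sigma>"
  shows "triple_le scale (s \<oplus>\<^sub>t q) s"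
proof -
  let ?o = "(0\<^sub>v 0, 0\<^sub>m 0 0, 0\<^sub>v 0) :: ('r, 'x) triple"
  obtain n where s: "sized n s"
    using assms(1) by (rule triples_sizedE)
  obtain m u F where q: "q = (u, F, 0\<^sub>v m)" "sized m (u, F, 0\<^sub>v m :: 'x vec)"
    using assms(2) by (rule right_zerosE)
  have o: "sized 0 ?o" by simp
  have "triple_le scale (s \<oplus>\<^sub>t q) (s \<oplus>\<^sub>t ?o)"
    unfolding q(1)
    by (rule triple_le_add[OF s s q(2) o triple_le_refl[OF s] zero_right_le_zero_left[OF o q(2)]])
  then show ?thesis
    unfolding triple_add_empty[OF s] .
qed

section \<open>From \<open>\<ge>\<close> to congruence, and from \<open>\<le>\<close> to
  \<open>\<ge>\<close>\<close>

text \<open>The matrices of \<open>\<ge>\<close> are bordered by identity blocks to make them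
  invertible. The price is one zero triple on each side, built from the data of the opposite
  triple.\<close>

lemma triple_ge_imp_cong:
  assumes s: "sized n (a, C, x)" and t: "sized m (b, D, y)"
    and ge: "triple_ge scale (a, C, x) (b, D, y)"
  shows "triple_cong scale ((a, C, x) \<oplus>\<^sub>t (b, D, 0\<^sub>v m)) ((b, D, y) \<oplus>\<^sub>t (0\<^sub>v n, C, x))"
proof -
  have car: "a \<in> carrier_vec n" "C \<in> carrier_mat n n" "x \<in> carrier_vec n"
    "b \<in> carrier_vec m" "D \<in> carrier_mat m m" "y \<in> carrier_vec m"
    using s t by auto
  obtain A\<^sub>1 A\<^sub>2 where A: "A\<^sub>1 \<in> carrier_mat m n" "A\<^sub>2 \<in> carrier_mat m n"
    "a = row_mult b A\<^sub>1" "y = mat_act scale A\<^sub>2 x" "D * A\<^sub>1 = A\<^sub>2 * C"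
    using triple_geE[OF ge] car by blast
  \<comment> \<open>In block form \<open>U A\<close> is [[A, 1], [1, 0]]. Thus the row (b, 0) goes
    to (b \<open>A\<^sub>1\<close>, b) = (a, b), and the column (x, 0) goes to
    (\<open>A\<^sub>2\<close> x, x) = (y, x).\<close>
  define U where "U A = four_block_mat A (1\<^sub>m m) (1\<^sub>m n) (0\<^sub>m n m)" for A :: "'r mat"
  have "U A\<^sub>1 \<in> inv_mats (dim_vec (a @\<^sub>v b))" "U A\<^sub>2 \<in> inv_mats (dim_vec (a @\<^sub>v b))"
    using off_diagonal_one_mats_inverse A(1,2) car unfolding U_def
    by (simp_all add: add.commute[of n])
  moreover have "dim_vec (a @\<^sub>v b) = dim_vec (b @\<^sub>v 0\<^sub>v n)"
    using car by simp
  moreover have "a @\<^sub>v b = row_mult (b @\<^sub>v 0\<^sub>v n) (U A\<^sub>1)"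
    unfolding U_def using A car by (subst row_mult_four_block[of _ m _ n _ n _ m]) auto
  moreover have "y @\<^sub>v x = mat_act scale (U A\<^sub>2) (x @\<^sub>v 0\<^sub>v m)"
    unfolding U_def using A car by (subst mat_act_four_block[of _ n _ m _ m _ _ n]) auto
  \<comment> \<open>Both products have the blocks \<open>D\<close>, \<open>C\<close> and
    \<open>0\<close> in the same places. Their upper left blocks are \<open>D * A\<^sub>1\<close>
    and \<open>A\<^sub>2 * C\<close>, which agree by the choice of the matrices.\<close>
  moreover have "four_block_mat D (0\<^sub>m m n) (0\<^sub>m n m) C * U A\<^sub>1
      = U A\<^sub>2 * four_block_mat C (0\<^sub>m n m) (0\<^sub>m m n) D"
    unfolding U_def using A car
    by (subst mult_four_block_mat[of _ m m _ n _ n _ _ n _ m], simp_all,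
        subst mult_four_block_mat[of _ m n _ m _ n _ _ n _ m])
      (simp_all add: left_one_mat_mult right_one_mat_mult)
  ultimately have "triple_cong scale (a @\<^sub>v b, four_block_mat C (0\<^sub>m n m) (0\<^sub>m m n) D, x @\<^sub>v 0\<^sub>v m)
      (b @\<^sub>v 0\<^sub>v n, four_block_mat D (0\<^sub>m m n) (0\<^sub>m n m) C, y @\<^sub>v x)"
    unfolding triple_cong.simps by blast
  then show ?thesis using car by (auto simp del: triple_cong.simps)
qed

lemma triples_ge_imp_cong:
  assumes s: "s \<in> triples \<Sigma>" and t: "t \<in> triples \<Sigma>" and ge: "triple_ge scale s t"
  shows "\<exists>p\<in>left_zeros \<Sigma>. \<exists>q\<in>right_zeros \<Sigma>. triple_cong scale (s \<oplus>\<^sub>t q) (t \<oplus>\<^sub>t p)"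
proof -
  obtain n a C x where s': "s = (a, C, x)" "n > 0" "sized n (a, C, x)" "C \<in> \<Sigma>"
    using s by (rule triplesE)
  obtain m b D y where t': "t = (b, D, y)" "m > 0" "sized m (b, D, y)" "D \<in> \<Sigma>"
    using t by (rule triplesE)
  have "(0\<^sub>v n, C, x) \<in> left_zeros \<Sigma>" "(b, D, 0\<^sub>v m :: 'x vec) \<in> right_zeros \<Sigma>"
    using s' t' by (auto intro: left_zerosI right_zerosI)
  then show ?thesis
    using triple_ge_imp_cong[OF s'(3) t'(3)] ge unfolding s'(1) t'(1) by blast
qed

text \<open>The relation \<open>\<le>\<close> expresses \<open>b\<close> through \<open>a\<close>
  and \<open>x\<close> through \<open>y\<close>, so what it expresses can be cancelled by a
  subtraction. The cancelled entries become the zero vectors of the two added triples.\<close>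

lemma triple_le_imp_ge:
  assumes s: "sized n (a, C, x)" and t: "sized m (b, D, y)"
    and le: "triple_le scale (a, C, x) (b, D, y)"
  shows "triple_ge scale ((a, C, x) \<oplus>\<^sub>t (0\<^sub>v m, D, y)) ((b, D, y) \<oplus>\<^sub>t (a, C, 0\<^sub>v n))"
proof -
  have car: "a \<in> carrier_vec n" "C \<in> carrier_mat n n" "x \<in> carrier_vec n"
    "b \<in> carrier_vec m" "D \<in> carrier_mat m m" "y \<in> carrier_vec m"
    using s t by auto
  obtain A\<^sub>1 A\<^sub>2 where A: "A\<^sub>1 \<in> carrier_mat n m" "A\<^sub>2 \<in> carrier_mat n m"
    "x = mat_act scale A\<^sub>1 y" "b = row_mult a A\<^sub>2" "C * A\<^sub>2 = A\<^sub>1 * D"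
    using triple_leE[OF le] car by blast
  \<comment> \<open>This has the shape of the inverse in
    \<open>off_diagonal_one_mats_inverse\<close>. The row (b, a) goes to (a, b - a
    \<open>A\<^sub>2\<close>) = (a, 0), and the column (x, y) goes to (y, x -
    \<open>A\<^sub>1\<close> y) = (y, 0).\<close>
  define U where "U A = four_block_mat (0\<^sub>m m n) (1\<^sub>m m) (1\<^sub>m n) (- A)" for A :: "'r mat"
  have "U A\<^sub>1 \<in> carrier_mat (m + n) (n + m)" "U A\<^sub>2 \<in> carrier_mat (m + n) (n + m)"
    using A by (simp_all add: U_def)
  moreover have "a @\<^sub>v 0\<^sub>v m = row_mult (b @\<^sub>v a) (U A\<^sub>2)"
    unfolding U_def using A car
    by (subst row_mult_four_block[of _ m _ n _ n _ m]) (auto simp: row_mult_uminus)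
  moreover have "y @\<^sub>v 0\<^sub>v n = mat_act scale (U A\<^sub>1) (x @\<^sub>v y)"
    unfolding U_def using A car
    by (subst mat_act_four_block[of _ n _ m _ m _ _ n]) (auto simp: mat_act_uminus)
  moreover have "four_block_mat D (0\<^sub>m m n) (0\<^sub>m n m) C * U A\<^sub>2
      = U A\<^sub>1 * four_block_mat C (0\<^sub>m n m) (0\<^sub>m m n) D"
    unfolding U_def using A car
    by (subst mult_four_block_mat[of _ m m _ n _ n _ _ n _ m], simp_all,
        subst mult_four_block_mat[of _ m n _ m _ n _ _ n _ m])
      (simp_all add: left_one_mat_mult right_one_mat_mult uminus_zero_mat)
  ultimately have "triple_ge scale (a @\<^sub>v 0\<^sub>v m, four_block_mat C (0\<^sub>m n m) (0\<^sub>m m n) D, x @\<^sub>v y)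
      (b @\<^sub>v a, four_block_mat D (0\<^sub>m m n) (0\<^sub>m n m) C, y @\<^sub>v 0\<^sub>v n)"
    \<comment> \<open>The indices are exchanged: the first matrix of \<open>\<le>\<close> acts on
      the column and the second on the row, while for \<open>\<ge>\<close> it is the other way
      round.\<close>
    using car by (intro triple_geI[of _ "n + m" _ "m + n" "U A\<^sub>2" "U A\<^sub>1"]) auto
  then show ?thesis using car by (auto simp del: triple_ge.simps)
qed

lemma triples_le_imp_ge:
  assumes s: "s \<in> triples \<Sigma>" and t: "t \<in> triples \<Sigma>" and le: "triple_le scale s t"
  shows "\<exists>p\<in>left_zeros \<Sigma>. \<exists>q\<in>right_zeros \<Sigma>. triple_ge scale (s \<oplus>\<^sub>t p) (t \<oplus>\<^sub>t q)"
proof -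
  obtain n a C x where s': "s = (a, C, x)" "n > 0" "sized n (a, C, x)" "C \<in> \<Sigma>"
    using s by (rule triplesE)
  obtain m b D y where t': "t = (b, D, y)" "m > 0" "sized m (b, D, y)" "D \<in> \<Sigma>"
    using t by (rule triplesE)
  have "(0\<^sub>v m, D, y) \<in> left_zeros \<Sigma>" "(a, C, 0\<^sub>v n :: 'x vec) \<in> right_zeros \<Sigma>"
    using s' t' by (auto intro: left_zerosI right_zerosI)
  then show ?thesis
    using triple_le_imp_ge[OF s'(3) t'(3)] le unfolding s'(1) t'(1) by blast
qed

section \<open>Bounds for zero triples and comparison up to them\<close>

text \<open>By induction on the generation of \<open>r\<close>. A left zero is its own upper bound
  and a right zero its own lower bound; the other bound keeps the same square matrix, with both
  vectors zero. For sums the bounds are added.\<close>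

lemma zero_triples_bounds:
  assumes \<Sigma>: "multiplicative \<Sigma>" and r: "r \<in> zero_triples \<Sigma>"
  shows "\<exists>p\<in>left_zeros \<Sigma>. \<exists>q\<in>right_zeros \<Sigma>. triple_ge scale p r \<and> triple_ge scale r q"
  using r
proof induction
  case (zero_left n C x)
  have p: "(0\<^sub>v n, C, x) \<in> left_zeros \<Sigma>"
    using zero_left unfolding left_zeros_def by blast
  have "n > 0 \<and> C \<in> \<Sigma> \<and> C \<in> carrier_mat n n"
    using zero_left by (auto simp: triples_def)
  then have q: "(0\<^sub>v n, C, 0\<^sub>v n :: 'x vec) \<in> right_zeros \<Sigma>"
    by (intro right_zerosI) simp_all
  show ?case
    by (rule bexI[OF _ p], rule bexI[OF _ q])
      (rule conjI[OF triples_ge_refl[OF zero_left] left_zero_ge_right_zero[OF p q]])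
next
  case (zero_right b D n)
  have "n > 0 \<and> D \<in> \<Sigma> \<and> D \<in> carrier_mat n n"
    using zero_right by (auto simp: triples_def)
  then have p: "(0\<^sub>v n, D, 0\<^sub>v n :: 'x vec) \<in> left_zeros \<Sigma>"
    by (intro left_zerosI) simp_all
  have q: "(b, D, 0\<^sub>v n :: 'x vec) \<in> right_zeros \<Sigma>"
    using zero_right unfolding right_zeros_def by blast
  show ?case
    by (rule bexI[OF _ p], rule bexI[OF _ q])
      (rule conjI[OF left_zero_ge_right_zero[OF p q] triples_ge_refl[OF zero_right]])
next
  case (add s t)
  obtain p q where s: "p \<in> left_zeros \<Sigma>" "q \<in> right_zeros \<Sigma>" "triple_ge scale p s" "triple_ge scale s q"
    using add.IH(1) by blast
  obtain p' q' where t: "p' \<in> left_zeros \<Sigma>" "q' \<in> right_zeros \<Sigma>" "triple_ge scale p' t" "triple_ge scale t q'"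
    using add.IH(2) by blast
  have triples: "s \<in> triples \<Sigma>" "t \<in> triples \<Sigma>" "p \<in> triples \<Sigma>" "q \<in> triples \<Sigma>"
    "p' \<in> triples \<Sigma>" "q' \<in> triples \<Sigma>"
    using zero_triples_subset[OF \<Sigma>] left_zeros_subset right_zeros_subset add.hyps s(1,2) t(1,2)
    by blast+
  have "triple_ge scale (p \<oplus>\<^sub>t p') (s \<oplus>\<^sub>t t)" "triple_ge scale (s \<oplus>\<^sub>t t) (q \<oplus>\<^sub>t q')"
    using triples_ge_add[OF triples(3,1,5,2) s(3) t(3)] triples_ge_add[OF triples(1,4,2,6) s(4) t(4)] .
  then show ?case
    using left_zeros_add[OF \<Sigma> s(1) t(1)] right_zeros_add[OF \<Sigma> s(2) t(2)] by blast
qed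

text \<open>Unlike in condition (2), the sizes of the two zero triples may differ here.\<close>

definition ge_upto_zeros :: "'r mat set \<Rightarrow> ('r, 'x) triple \<Rightarrow> ('r, 'x) triple \<Rightarrow> bool" where
  "ge_upto_zeros \<Sigma> s t \<longleftrightarrow>
     (\<exists>p\<in>left_zeros \<Sigma>. \<exists>q\<in>right_zeros \<Sigma>. triple_ge scale (s \<oplus>\<^sub>t p) (t \<oplus>\<^sub>t q))"

lemma ge_upto_zeros_equal_sizes:
  assumes \<Sigma>: "multiplicative \<Sigma>" and s: "s \<in> triples \<Sigma>" and t: "t \<in> triples \<Sigma>"
    and "ge_upto_zeros \<Sigma> s t"
  shows "\<exists>k>0. \<exists>u\<in>carrier_vec k. \<exists>E\<in>\<Sigma> \<inter> carrier_mat k k. \<exists>F\<in>\<Sigma> \<inter> carrier_mat k k. \<exists>z\<in>carrier_vec k.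
    triple_ge scale (s \<oplus>\<^sub>t (0\<^sub>v k, E, z)) (t \<oplus>\<^sub>t (u, F, 0\<^sub>v k))"
proof -
  obtain p q where p: "p \<in> left_zeros \<Sigma>" and q: "q \<in> right_zeros \<Sigma>"
    and ge: "triple_ge scale (s \<oplus>\<^sub>t p) (t \<oplus>\<^sub>t q)"
    using assms(4) unfolding ge_upto_zeros_def by blast
  obtain k E z where p': "p = (0\<^sub>v k, E, z)" "k > 0" "E \<in> \<Sigma> \<inter> carrier_mat k k" "z \<in> carrier_vec k"
    using p by (auto elim: left_zerosE)
  obtain l u F where q': "q = (u, F, 0\<^sub>v l)" "l > 0" "F \<in> \<Sigma> \<inter> carrier_mat l l" "u \<in> carrier_vec l"
    using q by (auto elim: right_zerosE)
  \<comment> \<open>The matrices are exchanged: \<open>p\<close> of size \<open>k\<close> gains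
    \<open>F\<close> of size \<open>l\<close>, and \<open>q\<close> of size \<open>l\<close> gains
    \<open>E\<close> of size \<open>k\<close>, so both reach size \<open>k + l\<close>. With both
    vectors zero, each new triple counts as a left and as a right zero.\<close>
  define p\<^sub>0 q\<^sub>0 where "p\<^sub>0 = (0\<^sub>v l :: 'r vec, F, 0\<^sub>v l :: 'x vec)" and "q\<^sub>0 = (0\<^sub>v k :: 'r vec, E, 0\<^sub>v k :: 'x vec)"
  have p\<^sub>0: "p\<^sub>0 \<in> left_zeros \<Sigma>" and q\<^sub>0: "q\<^sub>0 \<in> right_zeros \<Sigma>"
    using p' q' unfolding p\<^sub>0_def q\<^sub>0_def by (auto intro: left_zerosI right_zerosI)
  note sub = subsetD[OF left_zeros_subset] subsetD[OF right_zeros_subset]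
  have "triple_ge scale (s \<oplus>\<^sub>t p \<oplus>\<^sub>t p\<^sub>0) (t \<oplus>\<^sub>t q \<oplus>\<^sub>t q\<^sub>0)"
    by (rule triples_ge_add[OF triples_add[OF \<Sigma> s sub(1)[OF p]] triples_add[OF \<Sigma> t sub(2)[OF q]]
          sub(1)[OF p\<^sub>0] sub(2)[OF q\<^sub>0] ge left_zero_ge_right_zero[OF p\<^sub>0 q\<^sub>0]])
  moreover have "p \<oplus>\<^sub>t p\<^sub>0 = (0\<^sub>v (k + l), four_block_mat E (0\<^sub>m k l) (0\<^sub>m l k) F, z @\<^sub>v 0\<^sub>v l)"
    using p' q' by (auto simp: p\<^sub>0_def)
  moreover have "q \<oplus>\<^sub>t q\<^sub>0 = (u @\<^sub>v 0\<^sub>v k, four_block_mat F (0\<^sub>m l k) (0\<^sub>m k l) E, 0\<^sub>v (k + l))"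
    using p' q' by (auto simp: q\<^sub>0_def add.commute)
  moreover have "four_block_mat E (0\<^sub>m k l) (0\<^sub>m l k) F \<in> \<Sigma> \<inter> carrier_mat (k + l) (k + l)"
    "four_block_mat F (0\<^sub>m l k) (0\<^sub>m k l) E \<in> \<Sigma> \<inter> carrier_mat (k + l) (k + l)"
    using multiplicative_direct_sum[OF \<Sigma> p'(3) q'(3)] multiplicative_direct_sum[OF \<Sigma> q'(3) p'(3)]
    by (simp_all add: add.commute)
  moreover have "z @\<^sub>v 0\<^sub>v l \<in> carrier_vec (k + l)" "u @\<^sub>v 0\<^sub>v k \<in> carrier_vec (k + l)"
    using append_carrier_vec[OF p'(4), of "0\<^sub>v l" l] append_carrier_vec[OF q'(4), of "0\<^sub>v k" k]
    by (simp_all add: add.commute)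
  moreover have "k + l > 0"
    using p'(2) by simp
  ultimately show ?thesis
    unfolding triple_add_assoc by metis
qed

section \<open>Each condition compared with \<open>ge_upto_zeros\<close>\<close>

text \<open>With \<open>p\<close> above \<open>r\<close> and \<open>q\<close> below
  \<open>r'\<close>, the chain is s + p \<ge> s + r \<ge> t + r' \<ge> t + q, where the middle
  inequality comes from the congruence.\<close>

lemma triple_equiv_imp_ge_upto_zeros:
  assumes \<Sigma>: "multiplicative \<Sigma>" and s: "s \<in> triples \<Sigma>" and t: "t \<in> triples \<Sigma>"
    and "triple_equiv scale \<Sigma> s t"
  shows "ge_upto_zeros \<Sigma> s t"
proof -
  obtain r r' where r: "r \<in> zero_triples \<Sigma>" and r': "r' \<in> zero_triples \<Sigma>"
    and cong: "triple_cong scale (s \<oplus>\<^sub>t r) (t \<oplus>\<^sub>t r')"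
    using assms(4) unfolding triple_equiv_def by blast
  obtain p where p: "p \<in> left_zeros \<Sigma>" "triple_ge scale p r"
    using zero_triples_bounds[OF \<Sigma> r] by blast
  obtain q where q: "q \<in> right_zeros \<Sigma>" "triple_ge scale r' q"
    using zero_triples_bounds[OF \<Sigma> r'] by blast
  have triples: "r \<in> triples \<Sigma>" "r' \<in> triples \<Sigma>" "p \<in> triples \<Sigma>" "q \<in> triples \<Sigma>"
    using zero_triples_subset[OF \<Sigma>] left_zeros_subset right_zeros_subset r r' p(1) q(1) by blast+
  note sums = triples_add[OF \<Sigma> s triples(3)] triples_add[OF \<Sigma> s triples(1)]
    triples_add[OF \<Sigma> t triples(2)] triples_add[OF \<Sigma> t triples(4)]
  have "triple_ge scale (s \<oplus>\<^sub>t p) (s \<oplus>\<^sub>t r)"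
    by (rule triples_ge_add[OF s s triples(3,1) triples_ge_refl[OF s] p(2)])
  then have "triple_ge scale (s \<oplus>\<^sub>t p) (t \<oplus>\<^sub>t r')"
    using triple_cong_imp_ge[OF cong] by (rule triples_ge_trans[OF sums(1-3)])
  moreover have "triple_ge scale (t \<oplus>\<^sub>t r') (t \<oplus>\<^sub>t q)"
    by (rule triples_ge_add[OF t t triples(2,4) triples_ge_refl[OF t] q(2)])
  ultimately have "triple_ge scale (s \<oplus>\<^sub>t p) (t \<oplus>\<^sub>t q)"
    by (rule triples_ge_trans[OF sums(1,3,4)])
  then show ?thesis
    unfolding ge_upto_zeros_def using p(1) q(1) by blast
qed

text \<open>Turning the inequality into a congruence adds a right zero next to \<open>p\<close> and
  a left zero next to \<open>q\<close>. These mixed sums still lie in the generated subsemigroup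
  \<open>zero_triples \<Sigma>\<close>.\<close>

lemma ge_upto_zeros_imp_triple_equiv:
  assumes \<Sigma>: "multiplicative \<Sigma>" and s: "s \<in> triples \<Sigma>" and t: "t \<in> triples \<Sigma>"
    and "ge_upto_zeros \<Sigma> s t"
  shows "triple_equiv scale \<Sigma> s t"
proof -
  obtain p q where p: "p \<in> left_zeros \<Sigma>" and q: "q \<in> right_zeros \<Sigma>"
    and ge: "triple_ge scale (s \<oplus>\<^sub>t p) (t \<oplus>\<^sub>t q)"
    using assms(4) unfolding ge_upto_zeros_def by blast
  obtain p' q' where p': "p' \<in> left_zeros \<Sigma>" and q': "q' \<in> right_zeros \<Sigma>"
    and "triple_cong scale (s \<oplus>\<^sub>t p \<oplus>\<^sub>t q') (t \<oplus>\<^sub>t q \<oplus>\<^sub>t p')"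
    using triples_ge_imp_cong[OF triples_add[OF \<Sigma> s] triples_add[OF \<Sigma> t] ge]
      left_zeros_subset right_zeros_subset p q by blast
  then have "triple_cong scale (s \<oplus>\<^sub>t (p \<oplus>\<^sub>t q')) (t \<oplus>\<^sub>t (q \<oplus>\<^sub>t p'))"
    by (simp only: triple_add_assoc)
  moreover have "p \<oplus>\<^sub>t q' \<in> zero_triples \<Sigma>" "q \<oplus>\<^sub>t p' \<in> zero_triples \<Sigma>"
    using p q p' q' left_zeros_zero_triples right_zeros_zero_triples
    by (blast intro: zero_triples.add)+
  ultimately show ?thesis
    unfolding triple_equiv_def by blast
qed

text \<open>The intermediate triples are \<open>s \<oplus>\<^sub>t p\<close> and
  \<open>t \<oplus>\<^sub>t q\<close> themselves.\<close>

lemma ge_upto_zeros_imp_le_ge_le: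
  assumes \<Sigma>: "multiplicative \<Sigma>" and s: "s \<in> triples \<Sigma>" and t: "t \<in> triples \<Sigma>"
    and "ge_upto_zeros \<Sigma> s t"
  shows "\<exists>s'\<in>triples \<Sigma>. \<exists>t'\<in>triples \<Sigma>.
    triple_le scale s s' \<and> triple_ge scale s' t' \<and> triple_le scale t' t"
proof -
  obtain p q where p: "p \<in> left_zeros \<Sigma>" and q: "q \<in> right_zeros \<Sigma>"
    and ge: "triple_ge scale (s \<oplus>\<^sub>t p) (t \<oplus>\<^sub>t q)"
    using assms(4) unfolding ge_upto_zeros_def by blast
  have "s \<oplus>\<^sub>t p \<in> triples \<Sigma>" "t \<oplus>\<^sub>t q \<in> triples \<Sigma>"
    using triples_add[OF \<Sigma>] s t p q left_zeros_subset right_zeros_subset by blast+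
  then show ?thesis
    using ge triple_le_add_left_zero[OF s p] add_right_zero_triple_le[OF t q] by blast
qed

text \<open>Each \<open>\<le>\<close> is converted to a \<open>\<ge>\<close> at the cost of zero
  triples. The three inequalities are then padded to a common form and composed.\<close>

lemma le_ge_le_imp_ge_upto_zeros:
  assumes \<Sigma>: "multiplicative \<Sigma>" and s: "s \<in> triples \<Sigma>" and t: "t \<in> triples \<Sigma>"
    and s': "s' \<in> triples \<Sigma>" and t': "t' \<in> triples \<Sigma>"
    and le: "triple_le scale s s'" and ge: "triple_ge scale s' t'" and le': "triple_le scale t' t"
  shows "ge_upto_zeros \<Sigma> s t"
proof -
  note add = triples_add[OF \<Sigma>]
  obtain p q where p: "p \<in> left_zeros \<Sigma>" and q: "q \<in> right_zeros \<Sigma>"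
    and 1: "triple_ge scale (s \<oplus>\<^sub>t p) (s' \<oplus>\<^sub>t q)"
    using triples_le_imp_ge[OF s s' le] by blast
  have pq: "p \<in> triples \<Sigma>" "q \<in> triples \<Sigma>"
    using left_zeros_subset right_zeros_subset p q by blast+
  \<comment> \<open>Adding \<open>q\<close> before the conversion puts the new zeros
    \<open>p'\<close> and \<open>q'\<close> at the end of the sums, where associativity alone
    gathers them with \<open>p\<close> and \<open>q\<close>.\<close>
  have "triple_le scale (t' \<oplus>\<^sub>t q) (t \<oplus>\<^sub>t q)"
    by (rule triples_le_add[OF t' t pq(2,2) le' triples_le_refl[OF pq(2)]])
  then obtain p' q' where p': "p' \<in> left_zeros \<Sigma>" and q': "q' \<in> right_zeros \<Sigma>"
    and 2: "triple_ge scale (t' \<oplus>\<^sub>t q \<oplus>\<^sub>t p') (t \<oplus>\<^sub>t q \<oplus>\<^sub>t q')"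
    using triples_le_imp_ge[OF add[OF t' pq(2)] add[OF t pq(2)]] by blast
  have pq': "p' \<in> triples \<Sigma>" "q' \<in> triples \<Sigma>"
    using left_zeros_subset right_zeros_subset p' q' by blast+
  note sums = add[OF add[OF s pq(1)] pq'(1)] add[OF add[OF s' pq(2)] pq'(1)]
    add[OF add[OF t' pq(2)] pq'(1)] add[OF add[OF t pq(2)] pq'(2)]
  have "triple_ge scale (s \<oplus>\<^sub>t p \<oplus>\<^sub>t p') (s' \<oplus>\<^sub>t q \<oplus>\<^sub>t p')"
    by (rule triples_ge_add[OF add[OF s pq(1)] add[OF s' pq(2)] pq'(1,1) 1 triples_ge_refl[OF pq'(1)]])
  moreover have "triple_ge scale (s' \<oplus>\<^sub>t q \<oplus>\<^sub>t p') (t' \<oplus>\<^sub>t q \<oplus>\<^sub>t p')"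
    by (rule triples_ge_add[OF add[OF s' pq(2)] add[OF t' pq(2)] pq'(1,1)
          triples_ge_add[OF s' t' pq(2,2) ge triples_ge_refl[OF pq(2)]] triples_ge_refl[OF pq'(1)]])
  ultimately have "triple_ge scale (s \<oplus>\<^sub>t p \<oplus>\<^sub>t p') (t' \<oplus>\<^sub>t q \<oplus>\<^sub>t p')"
    by (rule triples_ge_trans[OF sums(1-3)])
  from triples_ge_trans[OF sums(1,3,4) this 2]
  have "triple_ge scale (s \<oplus>\<^sub>t (p \<oplus>\<^sub>t p')) (t \<oplus>\<^sub>t (q \<oplus>\<^sub>t q'))"
    by (simp only: triple_add_assoc)
  then show ?thesis
    unfolding ge_upto_zeros_def using left_zeros_add[OF \<Sigma> p p'] right_zeros_add[OF \<Sigma> q q'] by blast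
qed

end

theorem theorem11:
  fixes scale :: "'r::{ring,monoid_mult} \<Rightarrow> 'x::ab_group_add \<Rightarrow> 'x"
    and \<Sigma> :: "'r mat set"
    and a b :: "'r vec" and C D :: "'r mat" and x y :: "'x vec"
    and n m :: nat
  assumes "unital_left_module scale"
    and "multiplicative \<Sigma>"
    and "n > 0" and "m > 0"
    and "a \<in> carrier_vec n" and "C \<in> \<Sigma> \<inter> carrier_mat n n" and "x \<in> carrier_vec n"
    and "b \<in> carrier_vec m" and "D \<in> \<Sigma> \<inter> carrier_mat m m" and "y \<in> carrier_vec m"
  shows "(triple_equiv scale \<Sigma> (a, C, x) (b, D, y) \<longleftrightarrow>
           (\<exists>k>0. \<exists>u\<in>carrier_vec k. \<exists>E\<in>\<Sigma> \<inter> carrier_mat k k. \<exists>F\<in>\<Sigma> \<inter> carrier_mat k k.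
              \<exists>z\<in>carrier_vec k.
              triple_ge scale ((a, C, x) \<oplus>\<^sub>t (0\<^sub>v k, E, z)) ((b, D, y) \<oplus>\<^sub>t (u, F, 0\<^sub>v k)))) \<and>
         (triple_equiv scale \<Sigma> (a, C, x) (b, D, y) \<longleftrightarrow>
           (\<exists>a\<^sub>1 C\<^sub>1 x\<^sub>1 b\<^sub>1 D\<^sub>1 y\<^sub>1.
              (a\<^sub>1, C\<^sub>1, x\<^sub>1) \<in> triples \<Sigma> \<and> (b\<^sub>1, D\<^sub>1, y\<^sub>1) \<in> triples \<Sigma> \<and>
              triple_le scale (a, C, x) (a\<^sub>1, C\<^sub>1, x\<^sub>1) \<and>
              triple_ge scale (a\<^sub>1, C\<^sub>1, x\<^sub>1) (b\<^sub>1, D\<^sub>1, y\<^sub>1) \<and>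
              triple_le scale (b\<^sub>1, D\<^sub>1, y\<^sub>1) (b, D, y)))"
proof -
  interpret unital_left_module scale by fact
  have s: "(a, C, x) \<in> triples \<Sigma>" and t: "(b, D, y) \<in> triples \<Sigma>"
    using assms by (auto simp: triples_def)
  \<comment> \<open>Condition (1) is replaced by \<open>ge_upto_zeros\<close>, so that (2) and (3)
    are each compared with this one inequality.\<close>
  have equiv: "triple_equiv scale \<Sigma> (a, C, x) (b, D, y) \<longleftrightarrow> ge_upto_zeros \<Sigma> (a, C, x) (b, D, y)"
    using triple_equiv_imp_ge_upto_zeros[OF assms(2) s t]
      ge_upto_zeros_imp_triple_equiv[OF assms(2) s t] by blast
  show ?thesis
    unfolding equiv
  proof (intro conjI iffI)
    assume "ge_upto_zeros \<Sigma> (a, C, x) (b, D, y)"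
    then show "\<exists>k>0. \<exists>u\<in>carrier_vec k. \<exists>E\<in>\<Sigma> \<inter> carrier_mat k k. \<exists>F\<in>\<Sigma> \<inter> carrier_mat k k.
        \<exists>z\<in>carrier_vec k.
        triple_ge scale ((a, C, x) \<oplus>\<^sub>t (0\<^sub>v k, E, z)) ((b, D, y) \<oplus>\<^sub>t (u, F, 0\<^sub>v k))"
      by (rule ge_upto_zeros_equal_sizes[OF assms(2) s t])
  next
    assume "\<exists>k>0. \<exists>u\<in>carrier_vec k. \<exists>E\<in>\<Sigma> \<inter> carrier_mat k k. \<exists>F\<in>\<Sigma> \<inter> carrier_mat k k.
        \<exists>z\<in>carrier_vec k.
        triple_ge scale ((a, C, x) \<oplus>\<^sub>t (0\<^sub>v k, E, z)) ((b, D, y) \<oplus>\<^sub>t (u, F, 0\<^sub>v k))"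
    then obtain k u E F z where k: "k > 0" "u \<in> carrier_vec k" "z \<in> carrier_vec k"
      "E \<in> \<Sigma> \<inter> carrier_mat k k" "F \<in> \<Sigma> \<inter> carrier_mat k k"
      and ge: "triple_ge scale ((a, C, x) \<oplus>\<^sub>t (0\<^sub>v k, E, z)) ((b, D, y) \<oplus>\<^sub>t (u, F, 0\<^sub>v k))"
      by blast
    have "(0\<^sub>v k, E, z) \<in> left_zeros \<Sigma>" "(u, F, 0\<^sub>v k :: 'x vec) \<in> right_zeros \<Sigma>"
      using k by (auto intro: left_zerosI right_zerosI)
    then show "ge_upto_zeros \<Sigma> (a, C, x) (b, D, y)"
      using ge unfolding ge_upto_zeros_def by blast
  next
    assume "ge_upto_zeros \<Sigma> (a, C, x) (b, D, y)"
    from ge_upto_zeros_imp_le_ge_le[OF assms(2) s t this]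
    show "\<exists>a\<^sub>1 C\<^sub>1 x\<^sub>1 b\<^sub>1 D\<^sub>1 y\<^sub>1.
        (a\<^sub>1, C\<^sub>1, x\<^sub>1) \<in> triples \<Sigma> \<and> (b\<^sub>1, D\<^sub>1, y\<^sub>1) \<in> triples \<Sigma> \<and>
        triple_le scale (a, C, x) (a\<^sub>1, C\<^sub>1, x\<^sub>1) \<and>
        triple_ge scale (a\<^sub>1, C\<^sub>1, x\<^sub>1) (b\<^sub>1, D\<^sub>1, y\<^sub>1) \<and>
        triple_le scale (b\<^sub>1, D\<^sub>1, y\<^sub>1) (b, D, y)"
      \<comment> \<open>The quantifiers over the two intermediate triples are split into quantifiers
        over their six components.\<close>
      by (simp only: Bex_def split_paired_Ex) blast
  next
    assume "\<exists>a\<^sub>1 C\<^sub>1 x\<^sub>1 b\<^sub>1 D\<^sub>1 y\<^sub>1.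
        (a\<^sub>1, C\<^sub>1, x\<^sub>1) \<in> triples \<Sigma> \<and> (b\<^sub>1, D\<^sub>1, y\<^sub>1) \<in> triples \<Sigma> \<and>
        triple_le scale (a, C, x) (a\<^sub>1, C\<^sub>1, x\<^sub>1) \<and>
        triple_ge scale (a\<^sub>1, C\<^sub>1, x\<^sub>1) (b\<^sub>1, D\<^sub>1, y\<^sub>1) \<and>
        triple_le scale (b\<^sub>1, D\<^sub>1, y\<^sub>1) (b, D, y)"
    then show "ge_upto_zeros \<Sigma> (a, C, x) (b, D, y)"
      using le_ge_le_imp_ge_upto_zeros[OF assms(2) s t] by blast
  qed
qed

end
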